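(* A maximum likelihood estimator does not exist for the class $\mathcal{P}_s$ for any $s<-1$.
   Context: Let $\mathcal{C}$ be the set of all closed (i.e. upper semicontinuous), proper concave functions $\varphi:\mathbb{R}\to[-\infty,\infty)$. For $s<0$ let $h_s(y)=(-y)_+^{1/s}$, where $x_+=\max(x,0)$, with $h_s(-\infty)=0$. Let $\lambda$ be Lebesgue measure on $\mathbb{R}$. The class of $s$-concave densities on $\mathbb{R}$ is $\mathcal{P}_s=\{p=h_s\circ\varphi:\ \varphi\in\mathcal{C},\ \int p\,d\lambda=1\}$. Let $X_1,\dots,X_n$ be i.i.d. random variables with density $p_0\in\mathcal{P}_s$, and let $\mathbb{P}_n=n^{-1}\sum_{i=1}^n\delta_{X_i}$ be their empirical measure. A maximum likelihood estimator of $p_0$ over $\mathcal{P}_s$ is $\widehat p_n=h_s(\widehat\varphi_n)$, where $\widehat\varphi_n$ maximizes $\Psi_n(\varphi)=\mathbb{P}_n\,(\log h_s)\circ\varphi=n^{-1}\sum_{i=1}^n\log h_s(\varphi(X_i))$ over all $\varphi\in\mathcal{C}$ for which $\int h_s(\varphi)\,d\lambda=1$.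
   Formalization: The maximum is taken only over those φ whose density h_s(φ) is finite at every observation; with a pole allowed at an observation, Ψ_n can equal +∞ (for example when n = 1) and a maximizer would trivially exist. *)

theory Defs
  imports "HOL-Probability.Probability"
begin

(* Closed proper concave functions from the reals to [-\<infinity>, \<infinity>).  As the value \<infinity> is
   excluded, no sum \<infinity> + (-\<infinity>) occurs in the concavity inequality; 0 * (-\<infinity>) never occurs
   because the weights are positive. *)
definition closed_proper_concave :: "(real \<Rightarrow> ereal) set" where
  "closed_proper_concave = {\<phi>.
     (\<forall>x. \<phi> x < \<infinity>) \<and>
     (\<exists>x. \<phi> x > - \<infinity>) \<and>
     (\<forall>x y t. 0 < t \<and> t < 1 \<longrightarrow>
        ereal (1 - t) * \<phi> x + ereal t * \<phi> y \<le> \<phi> ((1 - t) * x + t * y)) \<and>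
     (\<forall>a. open {x. \<phi> x < a})}"

(* h_s(y) = (-y)_+ to the power 1/s, for s < 0.  The exponent 1/s is negative, so the power is 0
   at infinity and, read in [0, \<infinity>], it is \<infinity> at 0; the real power function would
   give 0 powr (1 / s) = 0, which would make h_s non-monotone. *)
definition h_trans :: "real \<Rightarrow> ereal \<Rightarrow> ennreal" where
  "h_trans s y =
     (if y = - \<infinity> then 0
      else if y < 0 then ennreal ((- real_of_ereal y) powr (1 / s))
      else \<infinity>)"

definition admissible :: "real \<Rightarrow> (real \<Rightarrow> ereal) set" where
  "admissible s = {\<phi> \<in> closed_proper_concave. (\<integral>\<^sup>+ x. h_trans s (\<phi> x) \<partial>lborel) = 1}"

definition s_concave_densities :: "real \<Rightarrow> (real \<Rightarrow> ennreal) set" where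
  "s_concave_densities s = {(\<lambda>x. h_trans s (\<phi> x)) | \<phi>. \<phi> \<in> admissible s}"

definition log_ext :: "ennreal \<Rightarrow> ereal" where
  "log_ext p = (if p = 0 then - \<infinity> else if p = \<infinity> then \<infinity> else ereal (ln (enn2real p)))"

definition log_lik :: "real \<Rightarrow> nat \<Rightarrow> (nat \<Rightarrow> real) \<Rightarrow> (real \<Rightarrow> ereal) \<Rightarrow> ereal" where
  "log_lik s n x \<phi> = ereal (1 / real n) * (\<Sum>i<n. log_ext (h_trans s (\<phi> (x i))))"

(* The functions over which log_lik is maximised: those for which the density is finite at every
   observation, so that log_lik is a well-defined number in [-\<infinity>, \<infinity>).  For s < -1 a function
   h_s(\<phi>) with a pole (\<phi> = 0 at a single point) can still integrate to 1.  With a pole at an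
   observation the log-likelihood is improper: it is \<infinity>, or the undefined \<infinity> + (-\<infinity>) if the
   density also vanishes at another observation.  Such a function is not counted as a maximiser,
   nor as a competitor.  Poles away from the observations are allowed. *)
definition lik_domain :: "real \<Rightarrow> nat \<Rightarrow> (nat \<Rightarrow> real) \<Rightarrow> (real \<Rightarrow> ereal) set" where
  "lik_domain s n x = {\<phi> \<in> admissible s. \<forall>i<n. h_trans s (\<phi> (x i)) < \<infinity>}"

definition is_MLE :: "real \<Rightarrow> nat \<Rightarrow> (nat \<Rightarrow> real) \<Rightarrow> (real \<Rightarrow> ennreal) \<Rightarrow> bool" where
  "is_MLE s n x p \<longleftrightarrow>
     (\<exists>\<phi>\<in>lik_domain s n x.
        (\<forall>\<psi>\<in>lik_domain s n x. log_lik s n x \<psi> \<le> log_lik s n x \<phi>) \<and>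
        p = (\<lambda>t. h_trans s (\<phi> t)))"

end

theory Submission
  imports Defs
begin

text \<open>For \<open>s < -1\<close> the function \<open>\<bar>t\<bar> powr (1 / s)\<close> has an integrable pole at \<open>0\<close>.  Restrict it to an
  interval that contains all observations whatever the position \<open>m\<close> of the pole near the first
  observation; the normalising constant does not depend on \<open>m\<close>.  As \<open>m\<close> tends to the first
  observation, the density there tends to infinity, while it stays bounded below at the others.
  So the likelihood is unbounded, although it is finite at each competitor.\<close>

text \<open>Translation moves the pole to \<open>0\<close>, and reflection reduces both halves to
  the integral of \<open>t powr r\<close> over \<open>{0..L}\<close>, which is finite as
  \<open>r > -1\<close>.\<close>

lemma nn_integral_abs_diff_powr:
  fixes r L m :: real
  assumes r: "-1 < r" and L: "0 < L"
  shows "(\<integral>\<^sup>+ t. ennreal (\<bar>t - m\<bar> powr r) * indicator {m - L..m + L} t \<partial>lborel) =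
    ennreal (2 * L powr (r + 1) / (r + 1))"
proof -
  let ?I = "L powr (r + 1) / (r + 1)"
  have "((\<lambda>t. t powr r) has_integral ?I) {0..L}"
    using has_integral_powr_from_0[of r L] r L by simp
  then have right: "((\<lambda>t. \<bar>t\<bar> powr r) has_integral ?I) {0..L}"
    by (rule has_integral_eq[rotated]) simp
  then have left: "((\<lambda>t. \<bar>t\<bar> powr r) has_integral ?I) {- L..0}"
    using has_integral_reflect_real[of "\<lambda>t. \<bar>t\<bar> powr r" ?I L 0] by simp
  have "((\<lambda>t. \<bar>t\<bar> powr r) has_integral (?I + ?I)) {- L..L}"
    by (rule has_integral_combine[OF _ _ left right]) (use L in auto)
  then have int: "((\<lambda>t. \<bar>t\<bar> powr r) has_integral (2 * L powr (r + 1) / (r + 1))) {- L..L}"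
    by simp
  have "(\<integral>\<^sup>+ t. ennreal (\<bar>t - m\<bar> powr r) * indicator {m - L..m + L} t \<partial>lborel) =
      (\<integral>\<^sup>+ t. ennreal (\<bar>t\<bar> powr r) * indicator {- L..L} t \<partial>lborel)"
    by (subst nn_integral_real_affine[where c = 1 and t = m])
      (auto intro!: nn_integral_cong simp: indicator_def)
  also have "\<dots> = ennreal (2 * L powr (r + 1) / (r + 1))"
    by (rule nn_integral_has_integral_lebesgue'[OF _ int]) simp
  finally show ?thesis .
qed

text \<open>The value \<open>0\<close> at \<open>m\<close> creates the pole under
  \<open>h_trans\<close>; the value \<open>- \<infinity>\<close> far from \<open>m\<close> cuts the
  density off to \<open>0\<close>, so that its heavy tail does not spoil integrability.\<close>

definition tent :: "real \<Rightarrow> real \<Rightarrow> real \<Rightarrow> real \<Rightarrow> ereal" where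
  "tent c L m t = (if \<bar>t - m\<bar> \<le> L then ereal (- (c * \<bar>t - m\<bar>)) else - \<infinity>)"

lemma tent_closed_proper_concave:
  assumes c: "0 \<le> c" and L: "0 \<le> L"
  shows "tent c L m \<in> closed_proper_concave"
proof -
  have "ereal (1 - t) * tent c L m x + ereal t * tent c L m y
      \<le> tent c L m ((1 - t) * x + t * y)"
    if t: "0 < t" "t < 1" for x y t
  proof (cases "\<bar>x - m\<bar> \<le> L \<and> \<bar>y - m\<bar> \<le> L")
    case True
    let ?z = "(1 - t) * x + t * y"
    have "?z - m = (1 - t) * (x - m) + t * (y - m)"
      by (simp add: algebra_simps)
    then have z: "\<bar>?z - m\<bar> \<le> (1 - t) * \<bar>x - m\<bar> + t * \<bar>y - m\<bar>"
      using abs_triangle_ineq[of "(1 - t) * (x - m)" "t * (y - m)"] t by (simp add: abs_mult)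
    also have "\<dots> \<le> L"
      using convex_bound_le[of "\<bar>x - m\<bar>" L "\<bar>y - m\<bar>" "1 - t" t] True t by simp
    finally have "\<bar>?z - m\<bar> \<le> L" .
    moreover have "c * \<bar>?z - m\<bar> \<le> c * ((1 - t) * \<bar>x - m\<bar> + t * \<bar>y - m\<bar>)"
      using z c by (rule mult_left_mono)
    ultimately show ?thesis
      using True by (simp add: tent_def algebra_simps)
  next
    \<comment> \<open>One of the two points has value \<open>- \<infinity>\<close> and a positive
      weight, so the left side is \<open>- \<infinity>\<close>.\<close>
    case False
    then show ?thesis
      using t by (auto simp: tent_def)
  qed
  moreover have "open {x. tent c L m x < a}" for a
  proof (cases a)
    case (real b)
    have "closed {x. \<bar>x - m\<bar> \<le> L \<and> b \<le> - (c * \<bar>x - m\<bar>)}"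
      by (intro closed_Collect_conj closed_Collect_le continuous_intros)
    moreover have "{x. tent c L m x < a} = - {x. \<bar>x - m\<bar> \<le> L \<and> b \<le> - (c * \<bar>x - m\<bar>)}"
      using real by (auto simp: tent_def)
    ultimately show ?thesis
      by (simp add: open_Compl)
  next
    case PInf
    then have "{x. tent c L m x < a} = UNIV"
      by (auto simp: tent_def)
    then show ?thesis by simp
  qed simp
  moreover have "tent c L m x < \<infinity>" for x
    by (simp add: tent_def)
  moreover have "tent c L m m > - \<infinity>"
    using L by (simp add: tent_def)
  ultimately show ?thesis
    unfolding closed_proper_concave_def by blast
qed

text \<open>The pole is excluded: at \<open>t = m\<close> the left side is
  \<open>\<infinity>\<close>, whereas \<open>0 powr (1 / s) = 0\<close> on the right.\<close>

lemma h_trans_tent: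
  assumes "0 < c" and "t \<noteq> m"
  shows "h_trans s (tent c L m t) =
    ennreal (c powr (1 / s)) * (ennreal (\<bar>t - m\<bar> powr (1 / s)) * indicator {m - L..m + L} t)"
proof -
  have "\<bar>t - m\<bar> \<le> L \<longleftrightarrow> t \<in> {m - L..m + L}"
    by auto
  then show ?thesis
    using assms by (auto simp: tent_def h_trans_def powr_mult ennreal_mult')
qed

text \<open>With \<open>K\<close> the integral of the truncated power,
  \<open>c powr (1 / s) = 1 / K\<close>, so the total mass is \<open>1\<close>. This
  \<open>c\<close> depends on \<open>s\<close> and \<open>L\<close> only, hence \<open>m\<close> can
  move freely.\<close>

lemma tent_admissible:
  assumes s: "s < -1" and L: "0 < L"
    and c: "c = (2 * L powr (1 / s + 1) / (1 / s + 1)) powr (- s)"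
  shows "tent c L m \<in> admissible s"
proof -
  define K where "K = 2 * L powr (1 / s + 1) / (1 / s + 1)"
  have r: "- 1 < 1 / s"
    using s by (simp add: field_simps)
  then have K: "0 < K"
    using L by (simp add: K_def)
  then have c0: "0 < c"
    by (simp add: c flip: K_def)
  have cK: "c powr (1 / s) * K = 1"
    using K s powr_powr[of K "- s" "1 / s"] by (simp add: c powr_neg_one flip: K_def)
  have "(\<integral>\<^sup>+ t. h_trans s (tent c L m t) \<partial>lborel) =
      (\<integral>\<^sup>+ t. ennreal (c powr (1 / s)) *
        (ennreal (\<bar>t - m\<bar> powr (1 / s)) * indicator {m - L..m + L} t) \<partial>lborel)"
    \<comment> \<open>The formula of \<open>h_trans_tent\<close> is available off the pole, which is
      a null set.\<close>
    by (rule nn_integral_cong_AE)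
      (use AE_lborel_singleton[of m] in eventually_elim, use c0 in \<open>simp add: h_trans_tent\<close>)
  also have "\<dots> = ennreal (c powr (1 / s)) * ennreal K"
    by (subst nn_integral_cmult) (simp_all add: nn_integral_abs_diff_powr[OF r L] K_def)
  also have "\<dots> = 1"
    using cK by (simp flip: ennreal_mult')
  finally show ?thesis
    using tent_closed_proper_concave[of c L m] c0 L by (simp add: admissible_def)
qed

lemma log_ext_h_trans_tent:
  assumes "0 < c" and "t \<noteq> m" and "\<bar>t - m\<bar> \<le> L"
  shows "log_ext (h_trans s (tent c L m t)) = ereal (1 / s * (ln c + ln \<bar>t - m\<bar>))"
  using assms by (simp add: tent_def h_trans_def log_ext_def ln_powr ln_mult)

lemma log_lik_less_PInf:
  assumes "\<phi> \<in> lik_domain s n x"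
  shows "log_lik s n x \<phi> < \<infinity>"
proof -
  have "log_ext (h_trans s (\<phi> (x i))) \<noteq> \<infinity>" if "i < n" for i
    using assms that by (auto simp: lik_domain_def log_ext_def)
  then have "(\<Sum>i<n. log_ext (h_trans s (\<phi> (x i)))) \<noteq> \<infinity>"
    by (simp add: sum_Pinfty)
  then show ?thesis
    by (cases "\<Sum>i<n. log_ext (h_trans s (\<phi> (x i)))") (auto simp: log_lik_def)
qed

lemma log_lik_unbounded:
  fixes s :: real and x :: "nat \<Rightarrow> real" and B :: real
  assumes s: "s < -1" and n: "1 \<le> n"
  shows "\<exists>\<psi>\<in>lik_domain s n x. ereal B < log_lik s n x \<psi>"
proof -
  \<comment> \<open>The sum bounds the distance of each observation from \<open>x 0\<close>; the
    extra \<open>1\<close> allows for any \<open>m\<close> within distance \<open>1\<close> of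
    \<open>x 0\<close>.\<close>
  define L where "L = 1 + (\<Sum>i<n. \<bar>x i - x 0\<bar>)"
  have L1: "1 \<le> L"
    by (simp add: L_def sum_nonneg)
  define c where "c = (2 * L powr (1 / s + 1) / (1 / s + 1)) powr (- s)"
  have "0 < 1 / s + 1"
    using s by (simp add: field_simps)
  then have c0: "0 < c"
    using L1 by (simp add: c_def)
  \<comment> \<open>Once the term \<open>1 / s * ln \<bar>x 0 - m\<bar>\<close> exceeds
    \<open>T\<close>, the whole sum exceeds \<open>real n * B\<close>, if the other
    \<open>n - 1\<close> such terms are at least \<open>1 / s * ln L\<close>.\<close>
  define T where "T = real n * B - 1 / s * (real n * ln c + (real n - 1) * ln L)"
  \<comment> \<open>The minimum with \<open>1\<close> matches the slack in \<open>L\<close>. As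
    \<open>s < 0\<close>, distance below the exponential makes the first term exceed
    \<open>T + 1\<close>.\<close>
  define \<epsilon> where "\<epsilon> = min 1 (exp (s * (T + 1)))"
  have \<epsilon>: "0 < \<epsilon>"
    by (simp add: \<epsilon>_def)
  \<comment> \<open>The pole must avoid all observations, so that the density is finite at each of
    them; they are only finitely many.\<close>
  have "infinite {x 0<..<x 0 + \<epsilon>}"
    using \<epsilon> by simp
  then have "infinite ({x 0<..<x 0 + \<epsilon>} - x ` {..<n})"
    by (rule Diff_infinite_finite[rotated]) simp
  then obtain m where m: "x 0 < m" "m < x 0 + \<epsilon>" "m \<notin> x ` {..<n}"
    by (metis Diff_iff all_not_in_conv finite.emptyI greaterThanLessThan_iff)
  have ne: "x i \<noteq> m" if "i < n" for i
    using m that by auto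
  have le: "\<bar>x i - m\<bar> \<le> L" if "i < n" for i
  proof -
    have "\<bar>x i - x 0\<bar> \<le> (\<Sum>i<n. \<bar>x i - x 0\<bar>)"
      using that by (intro member_le_sum) auto
    moreover have "\<bar>x 0 - m\<bar> \<le> 1"
      using m by (simp add: \<epsilon>_def)
    ultimately show ?thesis
      by (simp add: L_def)
  qed
  have fin: "h_trans s (tent c L m (x i)) < \<infinity>" if "i < n" for i
    using ne[OF that] le[OF that] c0 by (simp add: tent_def h_trans_def)
  have dom: "tent c L m \<in> lik_domain s n x"
    using tent_admissible[OF s _ c_def, of m] L1 fin by (simp add: lik_domain_def)
  have lik: "log_lik s n x (tent c L m) =
      ereal (1 / real n * (\<Sum>i<n. 1 / s * (ln c + ln \<bar>x i - m\<bar>)))"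
    using c0 ne le by (simp add: log_lik_def log_ext_h_trans_tent)
  have "ln \<bar>x 0 - m\<bar> < s * (T + 1)"
  proof -
    have "\<bar>x 0 - m\<bar> < exp (s * (T + 1))"
      using m by (simp add: \<epsilon>_def)
    then show ?thesis
      using m by (metis abs_of_neg diff_less_0_iff_less exp_gt_zero ln_exp ln_less_cancel_iff neg_0_less_iff_less)
  qed
  then have big: "T < 1 / s * ln \<bar>x 0 - m\<bar>"
    using s by (simp add: field_simps)
  \<comment> \<open>Since \<open>1 / s\<close> is negative, the log-density decreases with the
    distance from the pole, which is at most \<open>L\<close>.\<close>
  have rest: "1 / s * ln L \<le> 1 / s * ln \<bar>x i - m\<bar>" if "i < n" for i
    using ne[OF that] le[OF that] s by (intro mult_left_mono_neg) (auto simp: divide_nonpos_nonneg)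
  have "real n * B = T + 1 / s * (real n * ln c + (real n - 1) * ln L)"
    by (simp add: T_def)
  also have "\<dots> = (\<Sum>i<n. 1 / s * ln c) + T + (\<Sum>i\<in>{..<n} - {0}. 1 / s * ln L)"
    using n by (simp add: algebra_simps of_nat_diff diff_divide_distrib)
  also have "\<dots> < (\<Sum>i<n. 1 / s * ln c) + 1 / s * ln \<bar>x 0 - m\<bar>
      + (\<Sum>i\<in>{..<n} - {0}. 1 / s * ln \<bar>x i - m\<bar>)"
    using big by (intro add_less_le_mono add_strict_left_mono sum_mono rest) auto
  also have "\<dots> = (\<Sum>i<n. 1 / s * ln c) + (\<Sum>i<n. 1 / s * ln \<bar>x i - m\<bar>)"
    using n by (subst sum.remove[of "{..<n}" 0]) auto
  also have "\<dots> = (\<Sum>i<n. 1 / s * (ln c + ln \<bar>x i - m\<bar>))"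
    by (simp add: sum.distrib distrib_left)
  finally have "B < 1 / real n * (\<Sum>i<n. 1 / s * (ln c + ln \<bar>x i - m\<bar>))"
    using n by (simp add: field_simps)
  then show ?thesis
    using dom lik by (metis less_ereal.simps(1))
qed

lemma no_MLE:
  assumes "s < -1" and "1 \<le> n"
  shows "\<not> is_MLE s n x p"
proof
  assume "is_MLE s n x p"
  then obtain \<phi> where \<phi>: "\<phi> \<in> lik_domain s n x"
    and max: "\<And>\<psi>. \<psi> \<in> lik_domain s n x \<Longrightarrow> log_lik s n x \<psi> \<le> log_lik s n x \<phi>"
    by (auto simp: is_MLE_def)
  \<comment> \<open>The value may be \<open>- \<infinity>\<close>, so \<open>B\<close> is only an
    upper bound.\<close>
  obtain B where "log_lik s n x \<phi> \<le> ereal B"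
    using log_lik_less_PInf[OF \<phi>] by (cases "log_lik s n x \<phi>") auto
  moreover obtain \<psi> where "\<psi> \<in> lik_domain s n x" "ereal B < log_lik s n x \<psi>"
    using log_lik_unbounded[OF assms] by blast
  ultimately show False
    using max by (meson leD le_less_trans less_le_trans)
qed

theorem proposition2p1:
  fixes s :: real and n :: nat
    and M :: "'a measure" and X :: "nat \<Rightarrow> 'a \<Rightarrow> real" and p\<^sub>0 :: "real \<Rightarrow> ennreal"
  assumes "s < -1" and "n \<ge> 1"
    and "p\<^sub>0 \<in> s_concave_densities s"
    and "prob_space M"
    and "prob_space.indep_vars M (\<lambda>_. borel) X {..<n}"
    and "\<And>i. i < n \<Longrightarrow> distributed M lborel (X i) p\<^sub>0"
  shows "\<forall>\<omega>\<in>space M. \<not> (\<exists>p. is_MLE s n (\<lambda>i. X i \<omega>) p)"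
  using no_MLE[OF assms(1,2)] by blast

end
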